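(* Let $n \ge 2$ and let $0 \le p_1 < p_2 < \cdots < p_n \le 1$ be the blue-fractions of $n$ bichromatic urns (urn $i$ contains a $p_i$ fraction of blue balls and a $1-p_i$ fraction of red balls), and let $\epsilon = \min_{1 \le i \le n-1}(p_{i+1}-p_i)$. Then for Plurality Voting there is a voting scheme such that, for every $\eta \in (0,1)$, a number of voters $m = O\left(n^3 \epsilon^{-2} \ln \eta^{-1}\right)$ (with an absolute implicit constant) is sufficient to guarantee that, whichever urn is the correct one, with probability at least $1-\eta$ the correct urn receives strictly more votes than every other urn.
   Context: Voting model: one of the urns is chosen (adversarially) as the correct urn. Each of $m$ voters independently draws one ball (with replacement) from the correct urn, observes only its color (blue or red), and casts a vote for one urn according to a possibly randomized rule mapping the observed color to a probability distribution over the $n$ urns; all randomness of different voters is independent. A voting scheme is a specification of these rules (it may depend on $p_1,\dots,p_n$ but not on which urn is correct). Under Plurality Voting, each voter votes for exactly one urn, and the votes for each urn are counted. *)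

theory Defs
  imports "HOL-Probability.Probability" "HOL-Probability.Product_PMF"
begin

datatype color = Blue | Red

definition draw_ball :: "real \<Rightarrow> color pmf" where
  "draw_ball x = map_pmf (\<lambda>b. if b then Blue else Red) (bernoulli_pmf x)"

text \<open>A scheme gives the rule of voter \<open>v\<close> for every natural number \<open>v\<close>; an election with
  \<open>m\<close> voters uses the rules of the voters \<open>0, \<dots>, m - 1\<close>. The urns are \<open>1, \<dots>, n\<close>.\<close>

type_synonym scheme = "nat \<Rightarrow> color \<Rightarrow> nat pmf"

definition voting_scheme :: "nat \<Rightarrow> scheme \<Rightarrow> bool" where
  "voting_scheme n S \<longleftrightarrow> (\<forall>v c. set_pmf (S v c) \<subseteq> {1..n})"

definition vote :: "scheme \<Rightarrow> real \<Rightarrow> nat \<Rightarrow> nat pmf" where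
  "vote S x v = bind_pmf (draw_ball x) (S v)"

text \<open>Joint distribution of the votes when the correct urn has blue-fraction \<open>x\<close>. The default
  value \<open>0\<close> (not an urn) is taken outside the set of voters and is never counted.\<close>

definition election :: "scheme \<Rightarrow> real \<Rightarrow> nat \<Rightarrow> (nat \<Rightarrow> nat) pmf" where
  "election S x m = Pi_pmf {..<m} 0 (vote S x)"

definition vote_count :: "nat \<Rightarrow> (nat \<Rightarrow> nat) \<Rightarrow> nat \<Rightarrow> nat" where
  "vote_count m w j = card {v \<in> {..<m}. w v = j}"

definition plurality_winner :: "nat \<Rightarrow> nat \<Rightarrow> (nat \<Rightarrow> nat) \<Rightarrow> nat \<Rightarrow> bool" where
  "plurality_winner n m w i \<longleftrightarrow> (\<forall>j\<in>{1..n} - {i}. vote_count m w j < vote_count m w i)"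

definition min_gap :: "nat \<Rightarrow> (nat \<Rightarrow> real) \<Rightarrow> real" where
  "min_gap n p = Min ((\<lambda>i. p (i + 1) - p i) ` {1..n - 1})"

end

theory Submission
  imports Defs
begin

text \<open>
  The chance of a vote for urn \<open>j\<close> is an affine function of the blue-fraction of the correct urn,
  namely \<open>1/n\<close> plus a small multiple of a line, where the slopes of the \<open>n\<close> lines are equally spaced
  and all chances are of order \<open>1/n\<close>. The lines are placed such that at \<open>p\<^sub>i\<close> line \<open>i\<close> is ahead of
  line \<open>j\<close> by at least a multiple of \<open>\<epsilon> k\<^sup>2/n\<^sup>2\<close>, where \<open>k = \<bar>i - j\<bar>\<close>. Chernoff's bound for a pair
  of urns then shows that \<open>j\<close> gets at least as many votes as \<open>i\<close> with probability at most
  \<open>exp (- x k\<^sup>4)\<close>, where \<open>x\<close> is a multiple of \<open>m \<epsilon>\<^sup>2/n\<^sup>3\<close>. If \<open>x\<close> is large, the union bound loses no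
  factor \<open>n\<close>, since the sum over \<open>k\<close> converges.

  If \<open>x\<close> is small, \<open>\<eta>\<close> may be close to \<open>1\<close>, and one has to show that urn \<open>i\<close> wins with probability at
  least a multiple of \<open>x\<close>. With probability at least \<open>1/2\<close>, urn \<open>i\<close> beats all urns with \<open>k > K\<close>, where
  \<open>K\<close> is a multiple of \<open>1 / sqrt x\<close>; by symmetry, \<open>i\<close> is at least as likely to be among the top urns
  as any of the others. Hence \<open>i\<close> is among the top urns with probability at least a multiple of
  \<open>sqrt x\<close>. One further vote for \<open>i\<close> removes the ties, and a second moment argument shows that this
  costs no more than squaring the probability.
\<close>

section \<open>Independent identically distributed ballots\<close>

text \<open>An arbitrary set of voters is allowed, so that a single voter can be removed.\<close>

definition tally :: "'v set \<Rightarrow> ('v \<Rightarrow> 'a) \<Rightarrow> 'a \<Rightarrow> nat" where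
  "tally A w j = card {v \<in> A. w v = j}"

text \<open>Ties count as being on top, so for nonempty finite \<open>J\<close> every outcome has a
  top candidate; the pigeonhole argument below rests on this.\<close>

definition top_candidate :: "'v set \<Rightarrow> 'a set \<Rightarrow> ('v \<Rightarrow> 'a) \<Rightarrow> 'a \<Rightarrow> bool" where
  "top_candidate A J w i \<longleftrightarrow> (\<forall>j\<in>J. tally A w j \<le> tally A w i)"

definition strict_top_candidate :: "'v set \<Rightarrow> 'a set \<Rightarrow> ('v \<Rightarrow> 'a) \<Rightarrow> 'a \<Rightarrow> bool" where
  "strict_top_candidate A J w i \<longleftrightarrow> (\<forall>j\<in>J - {i}. tally A w j < tally A w i)"

lemma tally_eq_sum:
  assumes "finite A"
  shows "real (tally A w j) = (\<Sum>v\<in>A. of_bool (w v = j))"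
  using assms by (simp add: tally_def sum.If_cases of_bool_def Int_def)

lemma tally_remove_upd:
  assumes "finite A" "v \<in> A"
  shows "tally A (w(v := i)) j = tally (A - {v}) w j + of_bool (i = j)"
proof -
  have "{u \<in> A. (w(v := i)) u = j} =
      (if i = j then insert v {u \<in> A - {v}. w u = j} else {u \<in> A - {v}. w u = j})"
    using assms by auto
  moreover have "finite {u \<in> A - {v}. w u = j}" "v \<notin> {u \<in> A - {v}. w u = j}"
    using assms by auto
  ultimately show ?thesis unfolding tally_def by simp
qed

lemma prod_powers_tally:
  assumes "finite A" "i \<noteq> j"
  shows "(\<Prod>v\<in>A. if w v = i then a else if w v = j then b else (1::real)) =
    a ^ tally A w i * b ^ tally A w j"
proof -
  have "(\<Prod>v\<in>A. if w v = i then a else if w v = j then b else (1::real)) =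
      (\<Prod>v\<in>A. (if w v = i then a else 1) * (if w v = j then b else 1))"
    using assms by (intro prod.cong) auto
  also have "\<dots> = a ^ tally A w i * b ^ tally A w j"
    using assms by (simp add: prod.distrib tally_def prod.If_cases Int_def)
  finally show ?thesis .
qed

locale iid_ballots =
  fixes Q :: "'a pmf" and d :: 'a
  assumes finite_support: "finite (set_pmf Q)"
begin

definition ballots :: "'v set \<Rightarrow> ('v \<Rightarrow> 'a) pmf" where
  "ballots A = Pi_pmf A d (\<lambda>_. Q)"

lemma finite_set_ballots: "finite A \<Longrightarrow> finite (set_pmf (ballots A))"
  unfolding ballots_def
  by (rule finite_subset[OF set_Pi_pmf_subset']) (auto simp: finite_support)

lemma integrable_ballots [intro, simp]:
  fixes f :: "('v \<Rightarrow> 'a) \<Rightarrow> real"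
  shows "finite A \<Longrightarrow> integrable (measure_pmf (ballots A)) f"
  by (rule integrable_measure_pmf_finite) (rule finite_set_ballots)

text \<open>Chernoff's bound with the optimal tilt, which makes the moment generating function of a
  single ballot equal to \<open>1 - (sqrt q\<^sub>i - sqrt q\<^sub>j)\<^sup>2\<close>.\<close>

lemma prob_tally_le:
  assumes A: "finite A" and ij: "i \<noteq> j" and pos: "pmf Q i > 0" "pmf Q j > 0"
    and le: "pmf Q j \<le> pmf Q i"
  shows "measure_pmf.prob (ballots A) {w. tally A w i \<le> tally A w j}
    \<le> exp (- real (card A) * (sqrt (pmf Q i) - sqrt (pmf Q j))\<^sup>2)"
proof -
  define s where "s = sqrt (pmf Q i / pmf Q j)"
  have s1: "s \<ge> 1" unfolding s_def using pos le by simp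
  define f where "f = (\<lambda>x. if x = i then 1 / s else if x = j then s else (1::real))"
  have f0: "f x \<ge> 0" for x using s1 by (simp add: f_def)
  define D where "D = (sqrt (pmf Q i) - sqrt (pmf Q j))\<^sup>2"
  have Ef: "measure_pmf.expectation Q f = 1 - D"
  proof -
    have "f = (\<lambda>x. 1 + (1 / s - 1) * indicator {i} x + (s - 1) * indicator {j} x)"
      using ij by (auto simp: f_def fun_eq_iff indicator_def)
    then have "measure_pmf.expectation Q f =
        1 + (1 / s - 1) * pmf Q i + (s - 1) * pmf Q j"
      using finite_support
      by (simp add: integrable_measure_pmf_finite pmf.rep_eq)
    also have "pmf Q i / s = sqrt (pmf Q i) * sqrt (pmf Q j)"
      unfolding s_def using pos by (simp add: real_sqrt_divide field_simps)
    then have "(1 / s - 1) * pmf Q i = sqrt (pmf Q i) * sqrt (pmf Q j) - pmf Q i"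
      by (simp add: algebra_simps)
    also have "s * pmf Q j = sqrt (pmf Q i) * sqrt (pmf Q j)"
      unfolding s_def using pos by (simp add: real_sqrt_divide field_simps)
    then have "(s - 1) * pmf Q j = sqrt (pmf Q i) * sqrt (pmf Q j) - pmf Q j"
      by (simp add: algebra_simps)
    finally show ?thesis
      using pos by (simp add: D_def power2_eq_square algebra_simps)
  qed
  have "measure_pmf.prob (ballots A) {w. tally A w i \<le> tally A w j} =
      measure_pmf.expectation (ballots A) (indicator {w. tally A w i \<le> tally A w j})"
    by simp
  \<comment> \<open>Markov's inequality in exponential form: the product is \<open>s\<close> to the
    power of tally of \<open>j\<close> minus tally of \<open>i\<close>, which is at least 1 on the
    event because \<open>s \<ge> 1\<close>.\<close>
  also have "\<dots> \<le> measure_pmf.expectation (ballots A) (\<lambda>w. \<Prod>v\<in>A. f (w v))"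
  proof (rule integral_mono)
    fix w
    have "(\<Prod>v\<in>A. f (w v)) = (1 / s) ^ tally A w i * s ^ tally A w j"
      unfolding f_def by (rule prod_powers_tally[OF A ij])
    also have "\<dots> = s ^ tally A w j / s ^ tally A w i"
      by (simp add: power_one_over)
    finally have eq: "(\<Prod>v\<in>A. f (w v)) = s ^ tally A w j / s ^ tally A w i" .
    show "indicator {w. tally A w i \<le> tally A w j} w \<le> (\<Prod>v\<in>A. f (w v))"
      using s1 by (auto simp: eq indicator_def le_divide_eq power_increasing)
  qed (use A in auto)
  also have "\<dots> = (1 - D) ^ card A"
    unfolding ballots_def
    by (subst expectation_prod_Pi_pmf)
      (use A f0 finite_support in \<open>auto simp: Ef integrable_measure_pmf_finite\<close>)
  also have "\<dots> \<le> exp (- D) ^ card A"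
  proof (rule power_mono)
    show "1 - D \<le> exp (- D)" using exp_ge_add_one_self[of "- D"] by simp
    show "0 \<le> 1 - D" unfolding Ef[symmetric] using f0 by simp
  qed
  also have "\<dots> = exp (- real (card A) * D)"
    by (simp add: exp_of_nat_mult[symmetric])
  finally show ?thesis by (simp add: D_def)
qed

text \<open>Swapping the names \<open>i\<close> and \<open>j\<close> on all ballots maps the event on the left onto the one on the
  right, and does not decrease the probability of any outcome in which \<open>i\<close> is on top.\<close>

lemma prob_top_candidate_mono:
  assumes A: "finite A" and ij: "i \<in> J" "j \<in> J" "d \<noteq> i" "d \<noteq> j" and le: "pmf Q j \<le> pmf Q i"
  shows "measure_pmf.prob (ballots A) {w. top_candidate A J w j}
    \<le> measure_pmf.prob (ballots A) {w. top_candidate A J w i}"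
proof (cases "i = j")
  case False
  define \<sigma> where "\<sigma> = Transposition.transpose i j"
  have \<sigma>\<sigma>: "\<sigma> (\<sigma> x) = x" for x by (simp add: \<sigma>_def)
  have \<sigma>_eq: "\<sigma> x = y \<longleftrightarrow> x = \<sigma> y" for x y using \<sigma>\<sigma> by metis
  \<comment> \<open>The swap must fix the default value, since outcomes differing from
    \<open>d\<close> outside \<open>A\<close> have probability 0.\<close>
  have \<sigma>d: "\<sigma> d = d" using ij by (simp add: \<sigma>_def Transposition.transpose_def)
  have \<sigma>J: "\<sigma> x \<in> J" if "x \<in> J" for x using that ij by (auto simp: \<sigma>_def Transposition.transpose_def)
  have tally_\<sigma>: "tally A (\<sigma> \<circ> w) x = tally A w (\<sigma> x)" for w x
    unfolding tally_def by (simp add: \<sigma>_eq)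
  have top_\<sigma>: "top_candidate A J (\<sigma> \<circ> w) x \<longleftrightarrow> top_candidate A J w (\<sigma> x)" for w x
    unfolding top_candidate_def tally_\<sigma> by (metis \<sigma>J \<sigma>\<sigma>)
  have pmf_le: "pmf (ballots A) (\<sigma> \<circ> w) \<le> pmf (ballots A) w" if top: "top_candidate A J w i" for w
  proof (cases "\<forall>v. v \<notin> A \<longrightarrow> w v = d")
    case True
    define B where "B = {v \<in> A. w v \<noteq> i \<and> w v \<noteq> j}"
    have split: "(\<Prod>v\<in>A. g (w v)) = g i ^ tally A w i * g j ^ tally A w j * (\<Prod>v\<in>B. g (w v))"
      for g :: "'a \<Rightarrow> real"
    proof -
      have "(\<Prod>v\<in>A. g (w v)) = (\<Prod>v\<in>A. (if w v = i then g i else if w v = j then g j else 1) *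
          (if w v \<noteq> i \<and> w v \<noteq> j then g (w v) else 1))"
        by (intro prod.cong) auto
      also have "\<dots> = g i ^ tally A w i * g j ^ tally A w j * (\<Prod>v\<in>B. g (w v))"
        unfolding prod.distrib prod_powers_tally[OF A False]
        by (subst prod.inter_filter[OF A, symmetric]) (simp add: B_def)
      finally show ?thesis .
    qed
    have "pmf (ballots A) (\<sigma> \<circ> w) = (\<Prod>v\<in>A. pmf Q (\<sigma> (w v)))"
      unfolding ballots_def using True \<sigma>d by (subst pmf_Pi'[OF A]) auto
    also have "\<dots> = pmf Q j ^ tally A w i * pmf Q i ^ tally A w j * (\<Prod>v\<in>B. pmf Q (\<sigma> (w v)))"
      by (subst split) (simp add: \<sigma>_def)
    also have "(\<Prod>v\<in>B. pmf Q (\<sigma> (w v))) = (\<Prod>v\<in>B. pmf Q (w v))"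
      by (intro prod.cong) (auto simp: B_def \<sigma>_def Transposition.transpose_def)
    also have "pmf Q j ^ tally A w i * pmf Q i ^ tally A w j \<le>
        pmf Q i ^ tally A w i * pmf Q j ^ tally A w j"
    proof -
      \<comment> \<open>Swapping moves only the surplus \<open>k\<close> of \<open>i\<close> over
        \<open>j\<close>: it replaces a factor \<open>pmf Q i ^ k\<close> by
        \<open>pmf Q j ^ k\<close>.\<close>
      obtain k where k: "tally A w i = tally A w j + k"
        using top ij unfolding top_candidate_def by (metis le_add_diff_inverse)
      have "pmf Q j ^ k \<le> pmf Q i ^ k" using le by (intro power_mono) auto
      then have "(pmf Q i * pmf Q j) ^ tally A w j * pmf Q j ^ k
          \<le> (pmf Q i * pmf Q j) ^ tally A w j * pmf Q i ^ k"
        by (intro mult_left_mono) auto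
      then show ?thesis by (simp add: k power_add power_mult_distrib mult_ac)
    qed
    then have "pmf Q j ^ tally A w i * pmf Q i ^ tally A w j * (\<Prod>v\<in>B. pmf Q (w v)) \<le>
        pmf Q i ^ tally A w i * pmf Q j ^ tally A w j * (\<Prod>v\<in>B. pmf Q (w v))"
      by (intro mult_right_mono prod_nonneg) auto
    also have "\<dots> = pmf (ballots A) w"
      unfolding ballots_def using True by (subst pmf_Pi'[OF A]) (auto simp: split)
    finally show ?thesis .
  next
    case False
    then have "\<exists>v. v \<notin> A \<and> (\<sigma> \<circ> w) v \<noteq> d" using \<sigma>d \<sigma>_eq by auto
    then have "pmf (ballots A) (\<sigma> \<circ> w) = 0"
      unfolding ballots_def by (rule pmf_Pi_outside[OF A])
    then show ?thesis by simp
  qed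
  define F where "F = set_pmf (ballots A) \<inter> {w. top_candidate A J w j}"
  have F: "finite F" unfolding F_def using finite_set_ballots[OF A] by simp
  have inj: "inj_on (\<lambda>w. \<sigma> \<circ> w) F"
    by (rule inj_onI) (metis \<sigma>\<sigma> comp_apply ext)
  have "measure_pmf.prob (ballots A) {w. top_candidate A J w j} = measure_pmf.prob (ballots A) F"
    unfolding F_def using measure_Int_set_pmf[of "ballots A"] by (metis Int_commute)
  also have "\<dots> = (\<Sum>w\<in>F. pmf (ballots A) w)"
    by (rule measure_measure_pmf_finite[OF F])
  also have "\<dots> \<le> (\<Sum>w\<in>F. pmf (ballots A) (\<sigma> \<circ> w))"
  proof (rule sum_mono)
    fix w assume "w \<in> F"
    then have "top_candidate A J (\<sigma> \<circ> w) i" by (simp add: top_\<sigma> F_def) (simp add: \<sigma>_def)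
    from pmf_le[OF this] show "pmf (ballots A) w \<le> pmf (ballots A) (\<sigma> \<circ> w)"
      by (simp add: comp_def \<sigma>\<sigma>)
  qed
  also have "\<dots> = (\<Sum>w\<in>(\<lambda>w. \<sigma> \<circ> w) ` F. pmf (ballots A) w)"
    by (simp add: sum.reindex[OF inj])
  also have "\<dots> = measure_pmf.prob (ballots A) ((\<lambda>w. \<sigma> \<circ> w) ` F)"
    by (rule measure_measure_pmf_finite[symmetric]) (use F in simp)
  also have "\<dots> \<le> measure_pmf.prob (ballots A) {w. top_candidate A J w i}"
    by (intro measure_pmf.finite_measure_mono)
      (auto simp: F_def top_\<sigma>, simp add: \<sigma>_def)
  finally show ?thesis .
qed simp

section \<open>Moments of the tally of one candidate\<close>

lemma expectation_ballot_eq: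
  fixes f :: "('v \<Rightarrow> 'a) \<Rightarrow> real"
  assumes A: "finite A" and v: "v \<in> A"
  shows "measure_pmf.expectation (ballots A) (\<lambda>w. of_bool (w v = i) * f w) =
    pmf Q i * measure_pmf.expectation (ballots (A - {v})) (\<lambda>w. f (w(v := i)))"
proof -
  define E where "E = (\<lambda>a. measure_pmf.expectation (ballots (A - {v})) (\<lambda>w. f (w(v := a))))"
  have fin: "finite (A - {v})" using A by simp
  have "ballots A = Q \<bind> (\<lambda>y. map_pmf (\<lambda>w. w(v := y)) (ballots (A - {v})))"
    using Pi_pmf_insert'[OF fin, of v d "\<lambda>_. Q"] v
    by (simp add: ballots_def insert_absorb map_pmf_def)
  \<comment> \<open>Condition on the ballot of \<open>v\<close>. Adding \<open>i\<close> to the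
    support lets the sum collapse to its term even if \<open>pmf Q i = 0\<close>.\<close>
  then have "measure_pmf.expectation (ballots A) (\<lambda>w. of_bool (w v = i) * f w) =
      (\<Sum>a\<in>insert i (set_pmf Q). pmf Q a *
        measure_pmf.expectation (map_pmf (\<lambda>w. w(v := a)) (ballots (A - {v})))
          (\<lambda>w. of_bool (w v = i) * f w))"
    using finite_support finite_set_ballots[OF fin]
    by (simp add: pmf_expectation_bind[where A = "insert i (set_pmf Q)"] subset_insertI)
  also have "\<dots> = (\<Sum>a\<in>insert i (set_pmf Q). if a = i then pmf Q i * E i else 0)"
    by (intro sum.cong) (auto simp: E_def)
  also have "\<dots> = pmf Q i * E i" using finite_support by simp
  finally show ?thesis by (simp add: E_def)
qed

text \<open>Size biasing: weighting by the tally amounts to picking a voter, forcing a ballot for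
  \<open>i\<close> and leaving the other ballots random. It is applied with \<open>f\<close>
  constant, the tally itself, and the indicator of a strict win.\<close>

lemma expectation_tally_mult:
  fixes f :: "('v \<Rightarrow> 'a) \<Rightarrow> real"
  assumes A: "finite A"
  shows "measure_pmf.expectation (ballots A) (\<lambda>w. real (tally A w i) * f w) =
    pmf Q i * (\<Sum>v\<in>A. measure_pmf.expectation (ballots (A - {v})) (\<lambda>w. f (w(v := i))))"
proof -
  have "(\<lambda>w. real (tally A w i) * f w) = (\<lambda>w. \<Sum>v\<in>A. of_bool (w v = i) * f w)"
    by (simp only: tally_eq_sum[OF A] sum_distrib_right)
  then show ?thesis
    using A by (simp only: Bochner_Integration.integral_sum integrable_ballots
        expectation_ballot_eq sum_distrib_left cong: sum.cong)
qed

lemma expectation_tally: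
  assumes "finite A"
  shows "measure_pmf.expectation (ballots A) (\<lambda>w. real (tally A w i)) = card A * pmf Q i"
  using expectation_tally_mult[OF assms, of i "\<lambda>_. 1"] by simp

lemma expectation_tally_square_le:
  assumes A: "finite A"
  shows "measure_pmf.expectation (ballots A) (\<lambda>w. real (tally A w i) * real (tally A w i))
    \<le> card A * pmf Q i * (1 + card A * pmf Q i)"
proof -
  have "measure_pmf.expectation (ballots (A - {v})) (\<lambda>w. real (tally A (w(v := i)) i))
      \<le> 1 + card A * pmf Q i" if "v \<in> A" for v
  proof -
    have "measure_pmf.expectation (ballots (A - {v})) (\<lambda>w. real (tally A (w(v := i)) i)) =
        1 + card (A - {v}) * pmf Q i"
      using A that by (simp add: tally_remove_upd expectation_tally del: card_Diff_insert)
    also have "\<dots> \<le> 1 + card A * pmf Q i"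
      using A by (intro add_left_mono mult_right_mono) (auto simp: card_Diff1_le)
    finally show ?thesis .
  qed
  then have "(\<Sum>v\<in>A. measure_pmf.expectation (ballots (A - {v})) (\<lambda>w. real (tally A (w(v := i)) i)))
      \<le> (\<Sum>v\<in>A. 1 + card A * pmf Q i)"
    by (rule sum_mono)
  then have "pmf Q i * (\<Sum>v\<in>A. measure_pmf.expectation (ballots (A - {v}))
      (\<lambda>w. real (tally A (w(v := i)) i))) \<le> pmf Q i * (\<Sum>v\<in>A. 1 + card A * pmf Q i)"
    by (intro mult_left_mono) auto
  then show ?thesis
    unfolding expectation_tally_mult[OF A] by (simp add: mult_ac)
qed

text \<open>A ballot for \<open>i\<close> turns a tie at the top into a strict win. Averaging over the voter who casts
  it bounds the mean of the tally of \<open>i\<close> on the event of a strict win from below; the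
  Cauchy--Schwarz inequality then bounds the probability of that event.\<close>

lemma prob_strict_top_candidate_ge:
  assumes A: "finite A" and i: "i \<in> J" and pos: "A \<noteq> {}" "pmf Q i > 0" and W: "W \<ge> 0"
    and top: "\<And>v. v \<in> A \<Longrightarrow>
      W \<le> measure_pmf.prob (ballots (A - {v})) {w. top_candidate (A - {v}) J w i}"
  shows "measure_pmf.prob (ballots A) {w. strict_top_candidate A J w i}
    \<ge> W\<^sup>2 * (card A * pmf Q i / (1 + card A * pmf Q i))"
proof -
  define S where "S = {w. strict_top_candidate A J w i}"
  define c where "c = (\<lambda>w. real (tally A w i))"
  define \<mu> where "\<mu> = card A * pmf Q i"
  have \<mu>: "\<mu> > 0" using A pos by (simp add: \<mu>_def card_gt_0_iff)
  define P where "P = measure_pmf.prob (ballots A) S"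
  have "W \<le> measure_pmf.expectation (ballots (A - {v})) (\<lambda>w. indicator S (w(v := i)))"
    if v: "v \<in> A" for v
  proof -
    have "W \<le> measure_pmf.expectation (ballots (A - {v}))
        (indicator {w. top_candidate (A - {v}) J w i})"
      using top[OF v] by simp
    also have "\<dots> \<le> measure_pmf.expectation (ballots (A - {v})) (\<lambda>w. indicator S (w(v := i)))"
      using A i v by (intro integral_mono)
        (auto simp: S_def indicator_def strict_top_candidate_def top_candidate_def
          tally_remove_upd le_imp_less_Suc)
    finally show ?thesis .
  qed
  then have "(\<Sum>v\<in>A. W) \<le>
      (\<Sum>v\<in>A. measure_pmf.expectation (ballots (A - {v})) (\<lambda>w. indicator S (w(v := i))))"
    by (rule sum_mono)
  then have "pmf Q i * (\<Sum>v\<in>A. W) \<le> measure_pmf.expectation (ballots A) (\<lambda>w. c w * indicator S w)"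
    unfolding c_def expectation_tally_mult[OF A] by (intro mult_left_mono) auto
  then have lower: "\<mu> * W \<le> measure_pmf.expectation (ballots A) (\<lambda>w. c w * indicator S w)"
    by (simp add: \<mu>_def mult_ac)
  \<comment> \<open>Cauchy--Schwarz through a nonnegative square; this \<open>t\<close> maximises
    the resulting lower bound
    \<open>2 * t * (\<mu> * W) - t\<^sup>2 * (\<mu> * (1 + \<mu>))\<close>.\<close>
  define t where "t = W / (1 + \<mu>)"
  have t: "t \<ge> 0" using W \<mu> by (simp add: t_def)
  have "2 * t * (\<mu> * W) \<le> 2 * t * measure_pmf.expectation (ballots A) (\<lambda>w. c w * indicator S w)"
    using lower t by (intro mult_left_mono) auto
  also have "\<dots> = measure_pmf.expectation (ballots A) (\<lambda>w. 2 * t * (c w * indicator S w))"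
    by simp
  also have "\<dots> \<le> measure_pmf.expectation (ballots A) (\<lambda>w. t\<^sup>2 * (c w * c w) + indicator S w)"
  proof (rule integral_mono)
    fix w
    have "0 \<le> (t * c w - indicator S w)\<^sup>2" by simp
    then show "2 * t * (c w * indicator S w) \<le> t\<^sup>2 * (c w * c w) + indicator S w"
      by (cases "w \<in> S") (auto simp: power2_eq_square algebra_simps)
  qed (use A in auto)
  also have "\<dots> = t\<^sup>2 * measure_pmf.expectation (ballots A) (\<lambda>w. c w * c w) + P"
    using A by (simp add: P_def)
  also have "\<dots> \<le> t\<^sup>2 * (\<mu> * (1 + \<mu>)) + P"
    unfolding c_def \<mu>_def
    by (intro add_right_mono mult_left_mono expectation_tally_square_le A) auto
  finally have "2 * t * (\<mu> * W) - t\<^sup>2 * (\<mu> * (1 + \<mu>)) \<le> P" by simp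
  moreover have "2 * t * (\<mu> * W) - t\<^sup>2 * (\<mu> * (1 + \<mu>)) = W\<^sup>2 * (\<mu> / (1 + \<mu>))"
  proof -
    have "t\<^sup>2 * (\<mu> * (1 + \<mu>)) = t * \<mu> * (t * (1 + \<mu>))" by (simp add: power2_eq_square)
    also have "t * (1 + \<mu>) = W" using \<mu> by (simp add: t_def)
    finally have "2 * t * (\<mu> * W) - t\<^sup>2 * (\<mu> * (1 + \<mu>)) = t * \<mu> * W" by algebra
    then show ?thesis by (simp add: t_def power2_eq_square mult_ac)
  qed
  ultimately show ?thesis by (simp add: P_def S_def \<mu>_def)
qed

text \<open>Pigeonhole: in every outcome either a candidate in \<open>N\<close> is on top or one
  outside \<open>N\<close> has at least as many votes as \<open>i\<close>. By the swap, each of the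
  former is on top no more often than \<open>i\<close>.\<close>

lemma prob_top_candidate_ge:
  assumes A: "finite A" and J: "finite J" "d \<notin> J" and i: "i \<in> N" and N: "N \<subseteq> J"
    and le: "\<And>j. j \<in> N \<Longrightarrow> pmf Q j \<le> pmf Q i"
    and far: "(\<Sum>j\<in>J - N. measure_pmf.prob (ballots A) {w. tally A w i \<le> tally A w j}) \<le> \<delta>"
  shows "1 - \<delta> \<le> card N * measure_pmf.prob (ballots A) {w. top_candidate A J w i}"
proof -
  let ?P = "measure_pmf.prob (ballots A)"
  have fN: "finite N" using N J finite_subset by blast
  have "UNIV \<subseteq> (\<Union>j\<in>N. {w. top_candidate A J w j}) \<union>
      (\<Union>j\<in>J - N. {w. tally A w i \<le> tally A w j})"
  proof
    fix w :: "'b \<Rightarrow> 'a"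
    have "Max (tally A w ` J) \<in> tally A w ` J"
      using J i N by (intro Max_in) auto
    then obtain k where k: "k \<in> J" "Max (tally A w ` J) = tally A w k" by auto
    have top: "top_candidate A J w k"
      unfolding top_candidate_def k(2)[symmetric] using J by simp
    then have "tally A w i \<le> tally A w k" using i N by (auto simp: top_candidate_def)
    with top k(1) show "w \<in> (\<Union>j\<in>N. {w. top_candidate A J w j}) \<union>
      (\<Union>j\<in>J - N. {w. tally A w i \<le> tally A w j})" by blast
  qed
  then have "1 \<le> ?P ((\<Union>j\<in>N. {w. top_candidate A J w j}) \<union>
      (\<Union>j\<in>J - N. {w. tally A w i \<le> tally A w j}))"
    by (simp add: top.extremum_unique)
  also have "\<dots> \<le> ?P (\<Union>j\<in>N. {w. top_candidate A J w j}) +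
      ?P (\<Union>j\<in>J - N. {w. tally A w i \<le> tally A w j})"
    by (rule measure_Un_le) auto
  also have "?P (\<Union>j\<in>N. {w. top_candidate A J w j}) \<le> (\<Sum>j\<in>N. ?P {w. top_candidate A J w j})"
    by (rule measure_pmf.finite_measure_subadditive_finite) (use fN in auto)
  also have "\<dots> \<le> (\<Sum>j\<in>N. ?P {w. top_candidate A J w i})"
    using A J i N le by (intro sum_mono prob_top_candidate_mono) auto
  also have "?P (\<Union>j\<in>J - N. {w. tally A w i \<le> tally A w j}) \<le>
      (\<Sum>j\<in>J - N. ?P {w. tally A w i \<le> tally A w j})"
    by (rule measure_pmf.finite_measure_subadditive_finite) (use J in auto)
  also note far
  finally show ?thesis by simp
qed

lemma prob_strict_top_candidate_union_bound:
  assumes J: "finite J"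
  shows "1 - measure_pmf.prob (ballots A) {w. strict_top_candidate A J w i}
    \<le> (\<Sum>j\<in>J - {i}. measure_pmf.prob (ballots A) {w. tally A w i \<le> tally A w j})"
proof -
  let ?P = "measure_pmf.prob (ballots A)"
  have "1 - ?P {w. strict_top_candidate A J w i} = ?P (- {w. strict_top_candidate A J w i})"
    using measure_pmf.prob_compl[of "{w. strict_top_candidate A J w i}" "ballots A"]
    by (simp add: Compl_eq_Diff_UNIV)
  also have "- {w. strict_top_candidate A J w i} = (\<Union>j\<in>J - {i}. {w. tally A w i \<le> tally A w j})"
    by (auto simp: strict_top_candidate_def not_less[symmetric])
  also have "?P \<dots> \<le> (\<Sum>j\<in>J - {i}. ?P {w. tally A w i \<le> tally A w j})"
    by (rule measure_pmf.finite_measure_subadditive_finite) (use J in auto)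
  finally show ?thesis .
qed

end

section \<open>Vote probabilities from crossing lines\<close>

definition index_dist :: "nat \<Rightarrow> nat \<Rightarrow> nat" where
  "index_dist i j = nat \<bar>int i - int j\<bar>"

section \<open>Geometric sums over the distance between urns\<close>

lemma sum_powers_le_geometric_tail:
  fixes r :: real
  assumes r: "0 \<le> r" "r < 1" and S: "finite S" "\<And>k. k \<in> S \<Longrightarrow> K < k"
  shows "(\<Sum>k\<in>S. r ^ k) \<le> r ^ Suc K / (1 - r)"
proof -
  define T where "T = (\<lambda>k. k - Suc K) ` S"
  have inj: "inj_on (\<lambda>k. k - Suc K) S"
  proof (rule inj_onI)
    fix x y assume "x \<in> S" "y \<in> S" "x - Suc K = y - Suc K"
    then show "x = y" using S(2)[of x] S(2)[of y] by linarith
  qed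
  have "(\<Sum>k\<in>S. r ^ k) = (\<Sum>k\<in>S. r ^ Suc K * r ^ (k - Suc K))"
    by (rule sum.cong) (auto simp del: power_Suc simp add: power_add[symmetric] dest!: S(2))
  also have "\<dots> = r ^ Suc K * (\<Sum>k\<in>T. r ^ k)"
    by (simp add: T_def sum.reindex[OF inj] sum_distrib_left)
  also have "(\<Sum>k\<in>T. r ^ k) \<le> (\<Sum>k. r ^ k)"
    by (rule sum_le_suminf) (use r S in \<open>auto simp: T_def\<close>)
  also have "(\<Sum>k. r ^ k) = 1 / (1 - r)"
    using r by (simp add: suminf_geometric)
  finally show ?thesis using r by (simp add: mult_left_mono)
qed

text \<open>Each distance from \<open>i\<close> occurs at most once on either side of
  \<open>i\<close>, hence the factor 2.\<close>

lemma sum_powers_index_dist_le: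
  fixes r :: real
  assumes r: "0 \<le> r" "r < 1" and S: "finite S" "\<And>j. j \<in> S \<Longrightarrow> K < index_dist i j"
  shows "(\<Sum>j\<in>S. r ^ index_dist i j) \<le> 2 * r ^ Suc K / (1 - r)"
proof -
  have half: "(\<Sum>j\<in>B. r ^ index_dist i j) \<le> r ^ Suc K / (1 - r)"
    if B: "B \<subseteq> S" and inj: "inj_on (index_dist i) B" for B
  proof -
    have "(\<Sum>j\<in>B. r ^ index_dist i j) = (\<Sum>k\<in>index_dist i ` B. r ^ k)"
      by (simp add: sum.reindex[OF inj])
    also have "\<dots> \<le> r ^ Suc K / (1 - r)"
      by (rule sum_powers_le_geometric_tail)
        (use r S B in \<open>auto intro: finite_subset simp: subset_iff\<close>)
    finally show ?thesis .
  qed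
  have "S = {j \<in> S. j < i} \<union> {j \<in> S. i \<le> j}" by auto
  then have "(\<Sum>j\<in>S. r ^ index_dist i j) =
      (\<Sum>j | j \<in> S \<and> j < i. r ^ index_dist i j) + (\<Sum>j | j \<in> S \<and> i \<le> j. r ^ index_dist i j)"
    using S(1) by (subst sum.union_disjoint[symmetric]) auto
  also have "\<dots> \<le> r ^ Suc K / (1 - r) + r ^ Suc K / (1 - r)"
    by (intro add_mono half) (auto simp: inj_on_def index_dist_def)
  finally show ?thesis by simp
qed

lemma card_index_dist_le: "card {j. index_dist i j \<le> K} \<le> 2 * K + 1"
proof -
  have "{j. index_dist i j \<le> K} \<subseteq> {i - K..i + K}"
    by (auto simp: index_dist_def)
  then have "card {j. index_dist i j \<le> K} \<le> card {i - K..i + K}"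
    by (rule card_mono[rotated]) simp
  then show ?thesis by simp
qed

lemma finite_index_dist_le: "finite {j. index_dist i j \<le> K}"
  by (rule finite_subset[of _ "{..i + K}"]) (auto simp: index_dist_def)

text \<open>The lines \<open>line p 1, \<dots>, line p n\<close> have slopes \<open>0, \<dots>, n - 1\<close>, and consecutive ones cross at
  the midpoint of the two blue-fractions, so that line \<open>i\<close> is the largest one at \<open>p i\<close>. Equally
  spaced slopes make the lead linear in the minimal gap; tangents to a fixed parabola would only
  give a quadratic lead.\<close>

definition line :: "(nat \<Rightarrow> real) \<Rightarrow> nat \<Rightarrow> real \<Rightarrow> real" where
  "line p j x = (\<Sum>s\<in>{1..<j}. x - (p s + p (s + 1)) / 2)"

text \<open>Subtracting the mean of the lines makes the weights sum to 1. Lines are bounded by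
  \<open>n\<close>, so the divisor \<open>4 * real n ^ 2\<close> keeps every weight within
  \<open>1 / (2 * n)\<close> of \<open>1 / n\<close>.\<close>

definition weight :: "nat \<Rightarrow> (nat \<Rightarrow> real) \<Rightarrow> nat \<Rightarrow> real \<Rightarrow> real" where
  "weight n p j x = 1 / n + (line p j x - (\<Sum>k=1..n. line p k x) / n) / (4 * real n ^ 2)"

lemma line_affine: "line p j x = x * line p j 1 + (1 - x) * line p j 0"
  unfolding line_def sum_distrib_left sum.distrib[symmetric]
  by (intro sum.cong) (auto simp: field_simps)

text \<open>A voter sees blue with chance \<open>x\<close>, so the vote chance is a mixture of the
  rules for the two colors: exactly the affine functions of \<open>x\<close> can arise this
  way.\<close>

lemma weight_affine: "weight n p j x = x * weight n p j 1 + (1 - x) * weight n p j 0"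
proof -
  define c where "c = 4 * real n ^ 2"
  define L where "L = (\<lambda>x. (\<Sum>k=1..n. line p k x) / n)"
  have "(\<Sum>k=1..n. line p k x) = x * (\<Sum>k=1..n. line p k 1) + (1 - x) * (\<Sum>k=1..n. line p k 0)"
    unfolding sum_distrib_left sum.distrib[symmetric] by (intro sum.cong refl line_affine)
  then have L: "L x = x * L 1 + (1 - x) * L 0"
    by (simp add: L_def add_divide_distrib)
  have "weight n p j x = 1 / n + (line p j x - L x) / c" for x
    by (simp add: weight_def c_def L_def)
  moreover have "1 / n + (line p j x - L x) / c =
      x * (1 / n + (line p j 1 - L 1) / c) + (1 - x) * (1 / n + (line p j 0 - L 0) / c)"
    unfolding L line_affine[of p j x] diff_divide_distrib add_divide_distrib
    by (simp add: algebra_simps diff_divide_distrib)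
  ultimately show ?thesis by metis
qed

lemma sum_weight:
  assumes "n \<ge> 1"
  shows "(\<Sum>j=1..n. weight n p j x) = 1"
proof -
  define L where "L = (\<Sum>k=1..n. line p k x) / n"
  have "(\<Sum>j=1..n. line p j x - L) = 0"
    using assms by (simp add: sum_subtractf L_def)
  then have "(\<Sum>j=1..n. (line p j x - L) / (4 * real n ^ 2)) = 0"
    by (simp add: sum_divide_distrib[symmetric])
  then show ?thesis
    using assms by (simp add: weight_def sum.distrib L_def)
qed

lemma abs_line_le:
  assumes p: "p ` {1..n} \<subseteq> {0..1}" and x: "x \<in> {0..1}" and j: "j \<in> {1..n}"
  shows "\<bar>line p j x\<bar> \<le> n"
proof -
  have "\<bar>line p j x\<bar> \<le> (\<Sum>s\<in>{1..<j}. \<bar>x - (p s + p (s + 1)) / 2\<bar>)"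
    unfolding line_def by (rule sum_abs)
  also have "\<dots> \<le> (\<Sum>s\<in>{1..<j}. 1)"
  proof (rule sum_mono)
    fix s assume "s \<in> {1..<j}"
    then have "p s \<in> {0..1}" "p (s + 1) \<in> {0..1}" using p j by (auto simp: image_subset_iff)
    then show "\<bar>x - (p s + p (s + 1)) / 2\<bar> \<le> 1" using x by (simp add: abs_le_iff field_simps)
  qed
  also have "\<dots> \<le> n" using j by simp
  finally show ?thesis .
qed

lemma weight_bounds:
  assumes p: "p ` {1..n} \<subseteq> {0..1}" and x: "x \<in> {0..1}" and j: "j \<in> {1..n}"
  shows "weight n p j x \<in> {1 / (2 * n) .. 3 / (2 * n)}"
proof -
  have n: "real n > 0" using j by simp
  define L where "L = (\<Sum>k=1..n. line p k x) / n"
  have "\<bar>\<Sum>k=1..n. line p k x\<bar> \<le> (\<Sum>k=1..n. \<bar>line p k x\<bar>)" by (rule sum_abs)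
  also have "\<dots> \<le> (\<Sum>k=1..n. real n)" by (intro sum_mono abs_line_le p x)
  finally have "\<bar>L\<bar> \<le> n" using n by (simp add: L_def abs_divide divide_le_eq)
  then have "\<bar>line p j x - L\<bar> \<le> 2 * n" using abs_line_le[OF p x j] by linarith
  then have "\<bar>(line p j x - L) / (4 * real n ^ 2)\<bar> \<le> 2 * n / (4 * real n ^ 2)"
    unfolding abs_divide using divide_right_mono[of _ _ "4 * real n ^ 2"] by fastforce
  also have "\<dots> = 1 / (2 * n)" using n by (simp add: field_simps power2_eq_square)
  finally have "\<bar>weight n p j x - 1 / n\<bar> \<le> 1 / (2 * n)" by (simp add: weight_def L_def)
  moreover have "1 / real n = 2 * (1 / (2 * n))" "3 / (2 * real n) = 3 * (1 / (2 * n))" by simp_all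
  ultimately show ?thesis unfolding atLeastAtMost_iff of_nat_mult by (simp only: abs_le_iff) linarith
qed

lemma sum_odd_numbers: "(\<Sum>t<k. 2 * real t + 1) = real k ^ 2"
  by (induction k) (auto simp: power2_eq_square algebra_simps)

lemma spaced_diff_ge:
  fixes p :: "nat \<Rightarrow> real"
  assumes step: "\<And>s. s \<in> {1..<n} \<Longrightarrow> p s + \<epsilon> \<le> p (s + 1)" and "1 \<le> s" "s + k \<le> n"
  shows "p s + real k * \<epsilon> \<le> p (s + k)"
  using \<open>s + k \<le> n\<close>
proof (induction k)
  case (Suc k)
  then show ?case using step[of "s + k"] \<open>1 \<le> s\<close> by (simp add: algebra_simps)
qed simp

text \<open>The lead adds up the distances from \<open>p i\<close> to the crossing points between
  \<open>i\<close> and \<open>j\<close>. The one after \<open>t\<close> full gaps is at least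
  \<open>(t + 1/2) * \<epsilon>\<close> away, and summing odd numbers gives the square.\<close>

lemma line_lead_ge:
  assumes step: "\<And>s. s \<in> {1..<n} \<Longrightarrow> p s + \<epsilon> \<le> p (s + 1)" and i: "i \<in> {1..n}" and j: "j \<in> {1..n}"
  shows "line p i (p i) - line p j (p i) \<ge> \<epsilon> / 2 * real (index_dist i j) ^ 2"
proof (cases "i \<le> j")
  case True
  define k where "k = j - i"
  have j_eq: "j = i + k" and dist: "index_dist i j = k" using True by (auto simp: k_def index_dist_def)
  have "\<epsilon> / 2 * real k ^ 2 = (\<Sum>t<k. \<epsilon> / 2 * (2 * real t + 1))"
    by (simp add: sum_odd_numbers[symmetric] sum_distrib_left)
  also have "\<dots> \<le> (\<Sum>t<k. (p (i + t) + p (i + t + 1)) / 2 - p i)"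
  proof (rule sum_mono)
    fix t assume "t \<in> {..<k}"
    then have "p i + real t * \<epsilon> \<le> p (i + t)" "p i + real (t + 1) * \<epsilon> \<le> p (i + (t + 1))"
      using i j by (intro spaced_diff_ge[where p = p and n = n] step; simp add: j_eq)+
    then show "\<epsilon> / 2 * (2 * real t + 1) \<le> (p (i + t) + p (i + t + 1)) / 2 - p i"
      by (simp add: algebra_simps)
  qed
  also have "\<dots> = (\<Sum>s\<in>{i..<j}. (p s + p (s + 1)) / 2 - p i)"
    using sum.shift_bounds_nat_ivl[of "\<lambda>s. (p s + p (s + 1)) / 2 - p i" 0 i k]
    by (simp add: j_eq lessThan_atLeast0 add_ac)
  also have "\<dots> = - (\<Sum>s\<in>{i..<j}. p i - (p s + p (s + 1)) / 2)"
    by (simp add: sum_negf[symmetric])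
  also have "\<dots> = line p i (p i) - line p j (p i)"
    unfolding line_def
    using sum.atLeastLessThan_concat[of 1 i j "\<lambda>s. p i - (p s + p (s + 1)) / 2"] True i by simp
  finally show ?thesis by (simp add: dist)
next
  case False
  define k where "k = i - j"
  have i_eq: "i = j + k" and dist: "index_dist i j = k" using False by (auto simp: k_def index_dist_def)
  have "\<epsilon> / 2 * real k ^ 2 = (\<Sum>t<k. \<epsilon> / 2 * (2 * real t + 1))"
    by (simp add: sum_odd_numbers[symmetric] sum_distrib_left)
  \<comment> \<open>Counted upwards from \<open>j\<close>, the crossing points approach
    \<open>p i\<close>, so the odd numbers are taken in reverse order.\<close>
  also have "\<dots> = (\<Sum>t<k. \<epsilon> / 2 * (2 * real (k - Suc t) + 1))"
    by (rule sum.nat_diff_reindex[symmetric])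
  also have "\<dots> \<le> (\<Sum>t<k. p i - (p (j + t) + p (j + t + 1)) / 2)"
  proof (rule sum_mono)
    fix t assume t: "t \<in> {..<k}"
    have eq1: "j + t + (k - t) = i" and eq2: "j + t + 1 + (k - Suc t) = i" using t i_eq by auto
    have "p (j + t) + real (k - t) * \<epsilon> \<le> p (j + t + (k - t))"
      "p (j + t + 1) + real (k - Suc t) * \<epsilon> \<le> p (j + t + 1 + (k - Suc t))"
      using i j eq1 eq2 by (intro spaced_diff_ge[where p = p and n = n] step; simp)+
    moreover have "real (k - t) = real (k - Suc t) + 1" using t by auto
    ultimately show "\<epsilon> / 2 * (2 * real (k - Suc t) + 1) \<le> p i - (p (j + t) + p (j + t + 1)) / 2"
      unfolding eq1 eq2 by (simp add: field_simps)
  qed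
  also have "\<dots> = (\<Sum>s\<in>{j..<i}. p i - (p s + p (s + 1)) / 2)"
    using sum.shift_bounds_nat_ivl[of "\<lambda>s. p i - (p s + p (s + 1)) / 2" 0 j k]
    by (simp add: i_eq lessThan_atLeast0 add_ac)
  also have "\<dots> = line p i (p i) - line p j (p i)"
    unfolding line_def
    using sum.atLeastLessThan_concat[of 1 j i "\<lambda>s. p i - (p s + p (s + 1)) / 2"] False j by simp
  finally show ?thesis by (simp add: dist)
qed

lemma weight_lead_ge:
  assumes step: "\<And>s. s \<in> {1..<n} \<Longrightarrow> p s + \<epsilon> \<le> p (s + 1)" and "i \<in> {1..n}" "j \<in> {1..n}"
  shows "weight n p i (p i) - weight n p j (p i) \<ge> \<epsilon> * real (index_dist i j) ^ 2 / (8 * real n ^ 2)"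
proof -
  have "\<epsilon> * real (index_dist i j) ^ 2 / (8 * real n ^ 2) =
      (\<epsilon> / 2 * real (index_dist i j) ^ 2) / (4 * real n ^ 2)" by simp
  also have "\<dots> \<le> (line p i (p i) - line p j (p i)) / (4 * real n ^ 2)"
    using assms by (intro divide_right_mono line_lead_ge[where n = n]) auto
  also have "\<dots> = weight n p i (p i) - weight n p j (p i)"
    by (simp add: weight_def diff_divide_distrib)
  finally show ?thesis .
qed

text \<open>Each color uses the weights at the blue-fraction where that color is certain.\<close>

definition weight_rule :: "nat \<Rightarrow> (nat \<Rightarrow> real) \<Rightarrow> color \<Rightarrow> nat pmf" where
  "weight_rule n p c =
    embed_pmf (\<lambda>j. if j \<in> {1..n} then weight n p j (if c = Blue then 1 else 0) else 0)"

lemma pmf_weight_rule: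
  assumes n: "n \<ge> 1" and p: "p ` {1..n} \<subseteq> {0..1}"
  shows "pmf (weight_rule n p c) j =
    (if j \<in> {1..n} then weight n p j (if c = Blue then 1 else 0) else 0)"
proof -
  define x :: real where "x = (if c = Blue then 1 else 0)"
  have nonneg: "0 \<le> weight n p j x" if "j \<in> {1..n}" for j
    using weight_bounds[OF p _ that, of x] by (auto simp: x_def intro: order_trans[rotated])
  have "(\<integral>\<^sup>+ j. ennreal (if j \<in> {1..n} then weight n p j x else 0) \<partial>count_space UNIV) =
      (\<Sum>j=1..n. ennreal (if j \<in> {1..n} then weight n p j x else 0))"
    by (rule nn_integral_count_space') auto
  also have "\<dots> = (\<Sum>j=1..n. ennreal (weight n p j x))" by (intro sum.cong) auto
  also have "\<dots> = ennreal (\<Sum>j=1..n. weight n p j x)" using nonneg by (intro sum_ennreal) auto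
  finally have "(\<integral>\<^sup>+ j. ennreal (if j \<in> {1..n} then weight n p j x else 0) \<partial>count_space UNIV) = 1"
    using n by (simp only: sum_weight) simp
  then show ?thesis
    unfolding weight_rule_def x_def[symmetric]
    by (subst pmf_embed_pmf) (use nonneg in auto)
qed

lemma set_weight_rule:
  assumes "n \<ge> 1" "p ` {1..n} \<subseteq> {0..1}"
  shows "set_pmf (weight_rule n p c) \<subseteq> {1..n}"
  using pmf_weight_rule[OF assms] by (auto simp: set_pmf_eq split: if_splits)

lemma pmf_vote_weight_rule:
  assumes "n \<ge> 1" "p ` {1..n} \<subseteq> {0..1}" and x: "x \<in> {0..1}" and j: "j \<in> {1..n}"
  shows "pmf (vote (\<lambda>_. weight_rule n p) x v) j = weight n p j x"
  using j x by (simp add: vote_def draw_ball_def bind_map_pmf pmf_bind weight_affine[of n p j x]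
      pmf_weight_rule[OF assms(1,2)] mult_ac)

section \<open>Winning probability of the correct urn\<close>

text \<open>All that the probabilistic argument uses about the weights at the correct urn
  \<open>i\<close>. The default 0 is not an urn, as the swap requires.\<close>

locale peaked_ballots = iid_ballots Q 0 for Q :: "nat pmf" +
  fixes n i :: nat and \<epsilon> :: real
  assumes i: "i \<in> {1..n}" and \<epsilon>: "0 < \<epsilon>" "\<epsilon> \<le> 1"
    and bounds: "\<And>j. j \<in> {1..n} \<Longrightarrow> pmf Q j \<in> {1 / (2 * n) .. 3 / (2 * n)}"
    and lead: "\<And>j. j \<in> {1..n} \<Longrightarrow>
      pmf Q i - pmf Q j \<ge> \<epsilon> * real (index_dist i j) ^ 2 / (8 * real n ^ 2)"
begin

definition rate :: real where
  "rate = \<epsilon>\<^sup>2 / (384 * real n ^ 3)"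

lemma n_pos: "real n > 0" using i by simp

lemma rate_pos: "rate > 0" using n_pos \<epsilon> by (simp add: rate_def)

lemma pmf_pos: "j \<in> {1..n} \<Longrightarrow> pmf Q j > 0"
  using bounds[of j] n_pos by (auto intro: less_le_trans[rotated])

lemma pmf_le: "j \<in> {1..n} \<Longrightarrow> pmf Q j \<le> pmf Q i"
  using lead[of j] \<epsilon> by (smt (verit) divide_nonneg_nonneg mult_nonneg_nonneg zero_le_power2)

text \<open>Write the difference of roots as difference of chances over sum of roots. The squared
  sum is at most \<open>6 / n\<close> and the lead squared has denominator
  \<open>64 * n ^ 4\<close>, whence \<open>384 = 6 * 64\<close> in \<open>rate\<close>.\<close>

lemma sqrt_diff_square_ge:
  assumes j: "j \<in> {1..n}"
  shows "rate * real (index_dist i j) ^ 4 \<le> (sqrt (pmf Q i) - sqrt (pmf Q j))\<^sup>2"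
proof -
  define a b k where "a = sqrt (pmf Q i)" and "b = sqrt (pmf Q j)" and "k = real (index_dist i j)"
  have ab: "a\<^sup>2 = pmf Q i" "b\<^sup>2 = pmf Q j" "a \<ge> 0" "b \<ge> 0" by (simp_all add: a_def b_def)
  have "(a + b)\<^sup>2 \<le> 2 * a\<^sup>2 + 2 * b\<^sup>2"
    using zero_le_power2[of "a - b"] by (simp add: power2_eq_square algebra_simps)
  also have "\<dots> \<le> 2 * (3 / (2 * n)) + 2 * (3 / (2 * n))"
    unfolding ab using bounds[OF i] bounds[OF j] by (intro add_mono) auto
  also have "\<dots> = 6 / n" by simp
  finally have sum_le: "(a + b)\<^sup>2 \<le> 6 / n" .
  have "rate * k ^ 4 * (6 / n) = (\<epsilon> * k\<^sup>2 / (8 * real n ^ 2))\<^sup>2"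
    using n_pos by (simp add: rate_def field_simps power_mult_distrib power_divide eval_nat_numeral)
  also have "\<dots> \<le> (a\<^sup>2 - b\<^sup>2)\<^sup>2"
    unfolding ab using lead[OF j] \<epsilon> by (intro power_mono) (auto simp: k_def)
  also have "\<dots> = (a - b)\<^sup>2 * (a + b)\<^sup>2" by algebra
  also have "\<dots> \<le> (a - b)\<^sup>2 * (6 / n)" using sum_le by (intro mult_left_mono) auto
  finally show ?thesis using n_pos by (simp add: a_def b_def k_def divide_le_cancel)
qed

lemma prob_tally_le_exp:
  assumes A: "finite A" and j: "j \<in> {1..n}" "j \<noteq> i"
  shows "measure_pmf.prob (ballots A) {w. tally A w i \<le> tally A w j}
    \<le> exp (- (card A * rate * real (index_dist i j) ^ 4))"
proof -
  have "measure_pmf.prob (ballots A) {w. tally A w i \<le> tally A w j}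
      \<le> exp (- real (card A) * (sqrt (pmf Q i) - sqrt (pmf Q j))\<^sup>2)"
    using A i j pmf_pos pmf_le by (intro prob_tally_le) auto
  also have "\<dots> \<le> exp (- (card A * rate * real (index_dist i j) ^ 4))"
    using mult_left_mono[OF sqrt_diff_square_ge[OF j(1)], of "card A"] by (simp add: mult.assoc)
  finally show ?thesis .
qed

text \<open>Beyond distance \<open>K\<close> the exponent is at least \<open>k\<^sup>2 * y\<close>,
  hence at least \<open>k * y\<close>, and a geometric series takes over.\<close>

lemma sum_prob_tally_le:
  assumes A: "finite A" and S: "S \<subseteq> {1..n}" "\<And>j. j \<in> S \<Longrightarrow> K < index_dist i j"
    and y: "y > 0" and K: "y \<le> card A * rate * real (Suc K) ^ 2"
  shows "(\<Sum>j\<in>S. measure_pmf.prob (ballots A) {w. tally A w i \<le> tally A w j})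
    \<le> 2 * exp (- y) ^ Suc K / (1 - exp (- y))"
proof -
  have "measure_pmf.prob (ballots A) {w. tally A w i \<le> tally A w j} \<le> exp (- y) ^ index_dist i j"
    if j: "j \<in> S" for j
  proof -
    define k where "k = index_dist i j"
    have k: "Suc K \<le> k" using S(2)[OF j] by (simp add: k_def)
    have "j \<noteq> i" using S(2)[OF j] by (auto simp: index_dist_def)
    then have "measure_pmf.prob (ballots A) {w. tally A w i \<le> tally A w j}
        \<le> exp (- (card A * rate * real k ^ 4))"
      using A S j unfolding k_def by (intro prob_tally_le_exp) auto
    also have "card A * rate * real k ^ 4 \<ge> real k * y"
    proof -
      have "real k * y \<le> real k * real k * y"
        using y k by (intro mult_right_mono) auto
      also have "y \<le> card A * rate * real k ^ 2"
        by (rule order_trans[OF K]) (use k rate_pos in \<open>auto intro!: mult_left_mono power_mono\<close>)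
      then have "real k * real k * y \<le> real k * real k * (card A * rate * real k ^ 2)"
        by (intro mult_left_mono) auto
      also have "\<dots> = card A * rate * real k ^ 4" by (simp add: eval_nat_numeral)
      finally show ?thesis .
    qed
    then have "exp (- (card A * rate * real k ^ 4)) \<le> exp (- y) ^ k"
      by (simp add: exp_of_nat_mult[symmetric])
    finally show ?thesis by (simp add: k_def)
  qed
  then have "(\<Sum>j\<in>S. measure_pmf.prob (ballots A) {w. tally A w i \<le> tally A w j})
      \<le> (\<Sum>j\<in>S. exp (- y) ^ index_dist i j)" by (rule sum_mono)
  also have "\<dots> \<le> 2 * exp (- y) ^ Suc K / (1 - exp (- y))"
    by (rule sum_powers_index_dist_le) (use y S in \<open>auto intro: finite_subset\<close>)
  finally show ?thesis .
qed

section \<open>The regimes of the number of voters\<close>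

lemma prob_winner_many_voters:
  assumes A: "finite A" and x: "card A * rate \<ge> 4"
  shows "1 - exp (- (card A * rate) / 2)
    \<le> measure_pmf.prob (ballots A) {w. strict_top_candidate A {1..n} w i}"
proof -
  define x where "x = card A * rate"
  \<comment> \<open>The union bound is \<open>2 * y\<^sup>2 / (1 - y\<^sup>2)\<close>, at most
    \<open>y\<close> once \<open>y \<le> 1 / 3\<close>; giving up half the exponent absorbs the
    constants.\<close>
  define y where "y = exp (- x / 2)"
  have y0: "y > 0" by (simp add: y_def)
  have "1 + 2 \<le> exp (2::real)" by (rule exp_ge_add_one_self)
  also have "\<dots> \<le> exp (x / 2)" using assms by (simp add: x_def)
  finally have y3: "y \<le> 1 / 3" by (simp add: y_def exp_minus field_simps)
  have yy: "exp (- x) = y * y" by (simp add: y_def exp_add[symmetric])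
  have "1 - measure_pmf.prob (ballots A) {w. strict_top_candidate A {1..n} w i}
      \<le> (\<Sum>j\<in>{1..n} - {i}. measure_pmf.prob (ballots A) {w. tally A w i \<le> tally A w j})"
    by (rule prob_strict_top_candidate_union_bound) simp
  also have "\<dots> \<le> 2 * exp (- x) ^ Suc 0 / (1 - exp (- x))"
    by (rule sum_prob_tally_le[OF A]) (use assms in \<open>auto simp: x_def index_dist_def\<close>)
  also have "\<dots> \<le> y"
  proof -
    have "y * y \<le> 1 / 3 * (1 / 3)" using y0 y3 by (intro mult_mono) auto
    then have yy1: "1 - y * y > 0" "2 * y \<le> 1 - y * y" using y3 by auto
    then have "y * (2 * y) \<le> y * (1 - y * y)" using y0 by (intro mult_left_mono) auto
    then show ?thesis using yy1 unfolding yy by (simp add: divide_le_eq mult_ac)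
  qed
  finally show ?thesis by (simp add: y_def x_def)
qed

lemma prob_top_ge_sqrt:
  assumes A: "finite A" and x: "0 < card A * rate" "card A * rate \<le> 4"
  shows "sqrt (card A * rate) / 20 \<le> measure_pmf.prob (ballots A) {w. top_candidate A {1..n} w i}"
proof -
  define r where "r = sqrt (card A * rate)"
  have r0: "r > 0" and rr: "r\<^sup>2 = card A * rate" using x by (auto simp: r_def)
  have r2: "r \<le> 2" using x real_sqrt_le_mono[of "card A * rate" 4] by (simp add: r_def)
  \<comment> \<open>Chosen so that \<open>r * Suc K \<ge> 2\<close>: the tail bound then applies
    with \<open>y = 4\<close>, and \<open>exp (- 4) \<le> 1 / 5\<close> makes the far urns
    contribute at most 1/2.\<close>
  define K where "K = nat \<lceil>2 / r\<rceil>"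
  have K: "2 / r \<le> K" "K \<le> 2 / r + 1" using r0 by (auto simp: K_def)
  define N where "N = {j \<in> {1..n}. index_dist i j \<le> K}"
  have iN: "i \<in> N" using i by (simp add: N_def index_dist_def)
  have "4 \<le> card A * rate * real (Suc K) ^ 2"
  proof -
    have "2 \<le> r * real (Suc K)" using K(1) r0 by (simp add: field_simps)
    then have "2\<^sup>2 \<le> (r * real (Suc K))\<^sup>2" by (intro power_mono) auto
    then show ?thesis by (simp add: power_mult_distrib rr)
  qed
  then have "(\<Sum>j\<in>{1..n} - N. measure_pmf.prob (ballots A) {w. tally A w i \<le> tally A w j})
      \<le> 2 * exp (- 4) ^ Suc K / (1 - exp (- 4))"
    by (intro sum_prob_tally_le[OF A]) (auto simp: N_def)
  also have "\<dots> \<le> 1 / 2"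
  proof -
    have "1 + 4 \<le> exp (4::real)" by (rule exp_ge_add_one_self)
    then have e: "exp (- 4 :: real) \<le> 1 / 5" by (simp add: exp_minus field_simps)
    have "exp (- 4 :: real) ^ Suc K \<le> exp (- 4) ^ 1"
      by (intro power_decreasing) auto
    then have "exp (- 4 :: real) ^ Suc K \<le> 1 / 5" using e by (simp del: power_Suc)
    then show ?thesis using e by (simp add: divide_le_eq del: power_Suc)
  qed
  finally have "1 - 1 / 2 \<le> card N * measure_pmf.prob (ballots A) {w. top_candidate A {1..n} w i}"
    using iN pmf_le by (intro prob_top_candidate_ge[OF A]) (auto simp: N_def)
  also have "real (card N) \<le> 10 / r"
  proof -
    have "card N \<le> card {j. index_dist i j \<le> K}"
      by (rule card_mono[OF finite_index_dist_le]) (auto simp: N_def)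
    also have "\<dots> \<le> 2 * K + 1" by (rule card_index_dist_le)
    finally have "real (card N) \<le> 2 * K + 1" by linarith
    also have "\<dots> \<le> 2 * (2 / r + 1) + 1" using K by simp
    \<comment> \<open>As \<open>r \<le> 2\<close>, the constant 3 is at most
      \<open>6 / r\<close>.\<close>
    also have "\<dots> \<le> 10 / r" using r0 r2 by (simp add: field_simps)
    finally show ?thesis .
  qed
  finally show ?thesis using r0 by (simp add: r_def[symmetric] mult_right_mono field_simps)
qed

text \<open>The pigeonhole with all urns in \<open>N\<close>, hence no far urns.\<close>

lemma prob_top_ge_inverse:
  assumes A: "finite A"
  shows "1 / n \<le> measure_pmf.prob (ballots A) {w. top_candidate A {1..n} w i}"
proof -
  have "1 - 0 \<le> card {1..n} * measure_pmf.prob (ballots A) {w. top_candidate A {1..n} w i}"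
    using i pmf_le by (intro prob_top_candidate_ge[OF A]) auto
  then show ?thesis using n_pos by (simp add: field_simps)
qed

text \<open>The expected tally \<open>\<mu>\<close> may be tiny here, but
  \<open>\<mu> \<le> 3\<close> gives \<open>\<mu> / (1 + \<mu>) \<ge> m / (8 * n)\<close>. With
  \<open>W = 1 / n\<close> this yields \<open>m / (8 * n ^ 3)\<close>, enough because
  \<open>\<epsilon> \<le> 1\<close>.\<close>

lemma prob_winner_few_voters:
  assumes A: "finite A" and m: "card A \<le> 2 * n"
  shows "card A * rate \<le> measure_pmf.prob (ballots A) {w. strict_top_candidate A {1..n} w i}"
proof (cases "A = {}")
  case False
  define m where "m = real (card A)"
  have m0: "m > 0" using False A by (simp add: m_def card_gt_0_iff)
  define \<mu> where "\<mu> = m * pmf Q i"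
  have "m * (1 / (2 * n)) \<le> \<mu>" "\<mu> \<le> (2 * n) * (3 / (2 * n))"
    unfolding \<mu>_def using bounds[OF i] m m0 by (intro mult_mono; simp add: m_def)+
  then have \<mu>: "m / (2 * n) \<le> \<mu>" "\<mu> \<le> 3" "\<mu> > 0"
    using n_pos m0 pmf_pos[OF i] by (auto simp: \<mu>_def)
  have "\<epsilon>\<^sup>2 \<le> 1" using \<epsilon> by (simp add: power_le_one)
  then have "m * rate \<le> m * (1 / (8 * real n ^ 3))"
    unfolding rate_def using m0 n_pos by (intro mult_left_mono frac_le) auto
  also have "\<dots> = (1 / n)\<^sup>2 * (m / (2 * n) / 4)"
    using n_pos by (simp add: field_simps eval_nat_numeral)
  also have "\<dots> \<le> (1 / n)\<^sup>2 * (\<mu> / (1 + \<mu>))"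
    using \<mu> m0 by (intro mult_left_mono frac_le) auto
  also have "\<dots> \<le> measure_pmf.prob (ballots A) {w. strict_top_candidate A {1..n} w i}"
    unfolding \<mu>_def m_def using A i False pmf_pos[OF i]
    by (intro prob_strict_top_candidate_ge prob_top_ge_inverse) auto
  finally show ?thesis by (simp add: m_def)
qed simp

text \<open>Now \<open>\<mu> \<ge> 1\<close>, so \<open>\<mu> / (1 + \<mu>) \<ge> 1 / 2\<close>.
  Removing one of at least two voters at most halves \<open>card A * rate\<close>; squaring the
  square-root bound gives \<open>1600 = 2 * 400 * 2\<close>.\<close>

lemma prob_winner_intermediate:
  assumes A: "finite A" and m: "2 * n \<le> card A" and x: "card A * rate \<le> 4"
  shows "card A * rate / 1600
    \<le> measure_pmf.prob (ballots A) {w. strict_top_candidate A {1..n} w i}"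
proof -
  define m where "m = real (card A)"
  have m2: "m \<ge> 2" "m \<ge> 2 * n" using n_pos m by (auto simp: m_def)
  then have A0: "A \<noteq> {}" by (auto simp: m_def)
  define \<mu> where "\<mu> = m * pmf Q i"
  have "(2 * n) * (1 / (2 * n)) \<le> \<mu>"
    unfolding \<mu>_def using bounds[OF i] m2 by (intro mult_mono) auto
  then have \<mu>: "\<mu> \<ge> 1" using n_pos by simp
  have "sqrt (m * rate / 2) / 20 \<le>
      measure_pmf.prob (ballots (A - {v})) {w. top_candidate (A - {v}) {1..n} w i}"
    if v: "v \<in> A" for v
  proof -
    have c: "real (card (A - {v})) = m - 1"
      using A v m2 by (simp add: m_def card_Diff_singleton of_nat_diff)
    have "m * rate / 2 \<le> (m - 1) * rate" "(m - 1) * rate \<le> m * rate" "0 < (m - 1) * rate"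
      using m2 rate_pos by (auto simp: field_simps)
    then have "sqrt (m * rate / 2) / 20 \<le> sqrt (card (A - {v}) * rate) / 20"
      "0 < card (A - {v}) * rate" "card (A - {v}) * rate \<le> 4"
      using x unfolding c by (auto simp: m_def)
    with A show ?thesis by (intro order_trans[OF _ prob_top_ge_sqrt]) auto
  qed
  then have "(sqrt (m * rate / 2) / 20)\<^sup>2 * (card A * pmf Q i / (1 + card A * pmf Q i))
      \<le> measure_pmf.prob (ballots A) {w. strict_top_candidate A {1..n} w i}"
    using A A0 i pmf_pos[OF i] rate_pos m2 by (intro prob_strict_top_candidate_ge) auto
  then have main: "(sqrt (m * rate / 2) / 20)\<^sup>2 * (\<mu> / (1 + \<mu>))
      \<le> measure_pmf.prob (ballots A) {w. strict_top_candidate A {1..n} w i}"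
    by (simp add: \<mu>_def m_def)
  have "m * rate / 1600 = (sqrt (m * rate / 2) / 20)\<^sup>2 * (1 / 2)"
    using m2 rate_pos by (simp add: power_divide)
  also have "\<dots> \<le> (sqrt (m * rate / 2) / 20)\<^sup>2 * (\<mu> / (1 + \<mu>))"
    using \<mu> by (intro mult_left_mono) (auto simp: field_simps)
  also note main
  finally show ?thesis by (simp add: m_def)
qed

text \<open>One bound for all regimes: by \<open>1 - exp (- u) \<le> u\<close> it also lies below
  the linear bounds for small \<open>card A * rate\<close>.\<close>

lemma prob_winner_ge:
  assumes A: "finite A"
  shows "1 - exp (- (card A * rate / 1600))
    \<le> measure_pmf.prob (ballots A) {w. strict_top_candidate A {1..n} w i}"
proof -
  define x where "x = card A * rate"
  have x: "x \<ge> 0" using rate_pos by (simp add: x_def)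
  have lin: "1 - exp (- (x / 1600)) \<le> x / 1600"
    using exp_ge_add_one_self[of "- (x / 1600)"] by simp
  consider "x \<ge> 4" | "card A \<le> 2 * n" | "x \<le> 4" "2 * n \<le> card A" by linarith
  then show ?thesis
  proof cases
    case 1
    have "1 - exp (- (x / 1600)) \<le> 1 - exp (- x / 2)" using x by simp
    also note prob_winner_many_voters[OF A 1[unfolded x_def], folded x_def]
    finally show ?thesis by (simp add: x_def)
  next
    case 2
    have "1 - exp (- (x / 1600)) \<le> x" using lin x by simp
    also note prob_winner_few_voters[OF A 2, folded x_def]
    finally show ?thesis by (simp add: x_def)
  next
    case 3
    note lin
    also note prob_winner_intermediate[OF A 3(2) 3(1)[unfolded x_def], folded x_def]
    finally show ?thesis by (simp add: x_def)
  qed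
qed

end

theorem theorem1:
  shows "\<exists>C::real. C > 0 \<and>
    (\<forall>(n::nat) (p::nat \<Rightarrow> real).
      n \<ge> 2 \<and> 0 \<le> p 1 \<and> strict_mono_on {1..n} p \<and> p n \<le> 1 \<longrightarrow>
      (\<exists>S. voting_scheme n S \<and>
        (\<forall>(\<eta>::real) (m::nat).
          0 < \<eta> \<and> \<eta> < 1 \<and>
          real m \<ge> C * (real n ^ 3 * (1 / min_gap n p ^ 2) * ln (1 / \<eta>)) \<longrightarrow>
          (\<forall>i\<in>{1..n}.
            measure_pmf.prob (election S (p i) m) {w. plurality_winner n m w i} \<ge> 1 - \<eta>))))"
proof (intro exI[of _ "384 * 1600 :: real"] conjI allI impI)
  fix n :: nat and p :: "nat \<Rightarrow> real"
  assume asm: "n \<ge> 2 \<and> 0 \<le> p 1 \<and> strict_mono_on {1..n} p \<and> p n \<le> 1"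
  then have n: "n \<ge> 2" and mono: "strict_mono_on {1..n} p" by auto
  have p01: "p s \<in> {0..1}" if "s \<in> {1..n}" for s
  proof -
    have "p 1 \<le> p s" "p s \<le> p n"
      using that n strict_mono_on_imp_mono_on[OF mono] by (auto elim!: mono_onD)
    then show ?thesis using asm by auto
  qed
  then have p: "p ` {1..n} \<subseteq> {0..1}" by blast
  define \<epsilon> where "\<epsilon> = min_gap n p"
  have step: "p s + \<epsilon> \<le> p (s + 1)" if "s \<in> {1..<n}" for s
  proof -
    have "\<epsilon> \<le> p (s + 1) - p s"
      unfolding \<epsilon>_def min_gap_def using that by (intro Min_le) auto
    then show ?thesis by simp
  qed
  \<comment> \<open>The minimum is attained, so it is a genuine gap: positive, and at most 1 because
    the fractions lie in the unit interval.\<close>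
  have "\<epsilon> \<in> (\<lambda>i. p (i + 1) - p i) ` {1..n - 1}"
    unfolding \<epsilon>_def min_gap_def using n by (intro Min_in) auto
  then obtain s where s: "s \<in> {1..n - 1}" "\<epsilon> = p (s + 1) - p s" by auto
  have s': "s \<in> {1..n}" "s + 1 \<in> {1..n}" using s(1) n by auto
  then have \<epsilon>: "0 < \<epsilon>" "\<epsilon> \<le> 1"
    using s(2) p01[OF s'(1)] p01[OF s'(2)] strict_mono_onD[OF mono s'] by simp_all
  \<comment> \<open>All voters share one rule depending only on \<open>n\<close> and
    \<open>p\<close>, so it serves every \<open>\<eta>\<close> and \<open>m\<close>.\<close>
  define S :: scheme where "S = (\<lambda>_. weight_rule n p)"
  have S: "voting_scheme n S"
    unfolding voting_scheme_def S_def using set_weight_rule[OF _ p] n by simp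
  have "1 - \<eta> \<le> measure_pmf.prob (election S (p i) m) {w. plurality_winner n m w i}"
    if \<eta>: "0 < \<eta>" "\<eta> < 1" and i: "i \<in> {1..n}"
      and m: "real m \<ge> 384 * 1600 * (real n ^ 3 * (1 / \<epsilon> ^ 2) * ln (1 / \<eta>))" for \<eta> m i
  proof -
    define Q where "Q = vote S (p i) 0"
    have pmf_Q: "pmf Q j = weight n p j (p i)" if "j \<in> {1..n}" for j
      unfolding Q_def S_def using n p p01[OF i] that by (intro pmf_vote_weight_rule) auto
    have "set_pmf Q \<subseteq> {1..n}"
      unfolding Q_def vote_def using S by (auto simp: voting_scheme_def)
    then interpret peaked_ballots Q n i \<epsilon>
      by unfold_locales
        (use i \<epsilon> step pmf_Q weight_bounds[OF p p01[OF i]] weight_lead_ge[of n p \<epsilon> i]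
          in \<open>auto intro: finite_subset\<close>)
    have election: "election S (p i) m = ballots {..<m}"
    proof -
      have "vote S (p i) = (\<lambda>_. Q)" by (simp add: Q_def vote_def S_def fun_eq_iff)
      then show ?thesis by (simp add: election_def ballots_def)
    qed
    have winner: "plurality_winner n m w i \<longleftrightarrow> strict_top_candidate {..<m} {1..n} w i" for w
      by (simp add: plurality_winner_def strict_top_candidate_def vote_count_def tally_def)
    \<comment> \<open>The constant is the 384 of \<open>rate\<close> times the 1600 of
      \<open>prob_winner_ge\<close>.\<close>
    have "ln (1 / \<eta>) \<le> m * rate / 1600"
      using m \<epsilon> n unfolding rate_def by (simp add: field_simps)
    then have "- (m * rate / 1600) \<le> ln \<eta>" using \<eta> by (simp add: ln_div)
    then have "exp (- (m * rate / 1600)) \<le> exp (ln \<eta>)" by (simp only: exp_le_cancel_iff)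
    then have "1 - \<eta> \<le> 1 - exp (- (m * rate / 1600))" using \<eta> by simp
    also have "\<dots> \<le> measure_pmf.prob (election S (p i) m) {w. plurality_winner n m w i}"
      using prob_winner_ge[of "{..<m}"] by (simp add: election winner)
    finally show ?thesis .
  qed
  with S show "\<exists>S. voting_scheme n S \<and>
      (\<forall>\<eta> m. 0 < \<eta> \<and> \<eta> < 1 \<and>
        384 * 1600 * (real n ^ 3 * (1 / min_gap n p ^ 2) * ln (1 / \<eta>)) \<le> real m \<longrightarrow>
        (\<forall>i\<in>{1..n}.
          1 - \<eta> \<le> measure_pmf.prob (election S (p i) m) {w. plurality_winner n m w i}))"
    unfolding \<epsilon>_def by blast
qed simp

end
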